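(* Let $\tau\in(0,\tfrac12)$ and suppose the covering integer program (IP) formed by the constraints that arrive is feasible. Run Algorithm 1 (see context) on the constraints of (IP) online. Then, at any time, after constraints $1,\dots,m$ have been processed: (i) $\bar x$ is feasible for the LP relaxation (P), i.e. $0\le\bar x_i\le u_i$ for all $i$ and $\sum_{i\in S_j}a_{ij}\bar x_i\ge1$ for all $j\le m$; (ii) $\sum_{i=1}^n c_ix_i\le C\log k\cdot\mathrm{OPT}_{IP}$ for an absolute constant $C$, where $\mathrm{OPT}_{IP}$ is the optimal value of (IP) with constraints $1,\dots,m$ and $k$ is the algorithm's current parameter; (iii) for each $j\le m$, letting $H_j=\{i\in[n]: x^{(j)}_i\ge\tau u_i\}$ and $a_j(H_j)=\sum_{r\in H_j}a_{rj}u_r$, if $a_j(H_j)<1$ then $$\sum_{i\in S_j\setminus H_j}\min\{a_{ij},\,1-a_j(H_j)\}\cdot x^{(j)}_i\ \ge\ 1-a_j(H_j).$$ Furthermore, the vectors $x$ and $\bar x$ are non-decreasing over time.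
   Context: Online CIP: $n$ variables with costs $c_i>0$ and upper bounds $u_i>0$. Constraints $\sum_{i\in S_j}a_{ij}x_i\ge 1$ with $a_{ij}>0$ for $i\in S_j$ (and $a_{ij}=0$ otherwise) arrive one at a time, $j=1,2,\dots$. (IP) is $\min\{\sum_ic_ix_i: \sum_{i\in S_j}a_{ij}x_i\ge1\ \forall j,\ 0\le x_i\le u_i,\ x_i\in\mathbb{Z}\}$ and (P) is its LP relaxation (drop integrality). $\log=\log_2$. Algorithm 1 (threshold $\tau$): maintains $x\in\mathbb{R}^n$ (initially $0$), a counter $h$ (initially $0$), and the derived vector $\bar x$ with $\bar x_i=x_i$ if $x_i<\tau u_i$ and $\bar x_i=u_i$ otherwise. When constraint $j$ arrives, set $k$ to the smallest power of $2$ at least $\max\{2,|S_1|,\dots,|S_j|\}$, and: 1. $h\leftarrow h+1$, $t_h\leftarrow 0$, $F_j\leftarrow\{i\in S_j: x_i\ge\tau u_i\}$, $T_h\leftarrow S_j\setminus F_j$, $b\leftarrow 1-\sum_{i\in F_j}a_{ij}u_i$, $\alpha_{ih}\leftarrow\min\{1,a_{ij}/b\}$ for $i\in T_h$ and $\alpha_{ih}=0$ otherwise. If $b\le 0$, stop processing constraint $j$. 2. While $\sum_{i\in T_h}\alpha_{ih}x_i<1$: if $T_h=\emptyset$ output INFEASIBLE. Let $d_{ih}=c_i/\alpha_{ih}$ ($i\in T_h$), $d_{m(h)}=\min_{i\in T_h}d_{ih}$. Let $\delta$ be the largest value in $(0,1]$ with $\big(1+\delta\frac{d_{m(h)}}{d_{ih}}\big)x_i+\frac{\delta}{k\alpha_{ih}}\frac{d_{m(h)}}{d_{ih}}\le\tau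 u_i$ for all $i\in T_h$. Replace $x_i$ by the left-hand side of this inequality for every $i\in T_h$; set $t_h\leftarrow t_h+\delta$. Let $F'_h=\{i\in T_h: x_i=\tau u_i\}$ and $F_j\leftarrow F_j\cup F'_h$. If $F'_h\neq\emptyset$: $h\leftarrow h+1$, $t_h\leftarrow0$, $T_h\leftarrow S_j\setminus F_j$, recompute $b\leftarrow1-\sum_{i\in F_j}a_{ij}u_i$ and $\alpha_{ih}\leftarrow\min\{1,a_{ij}/b\}$ for $i\in T_h$ ($0$ otherwise); if $b\le0$, stop processing constraint $j$. $x^{(j)}$ denotes the vector $x$ immediately after constraint $j$ has been processed. *)

theory Defs
  imports Complex_Main
begin

text \<open>
  Variables are numbered \<open>1..nvars\<close> and constraints \<open>1..ncons\<close>, in order of arrival;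
  \<open>coef P i j\<close> is \<open>a\<^sub>i\<^sub>j\<close>.  Dimensions are ordinary natural numbers (not types), so that a constant
  can be chosen before the instance, its dimension included.
\<close>

record cip =
  nvars :: nat
  ncons :: nat
  cost :: "nat \<Rightarrow> real"
  ub :: "nat \<Rightarrow> real"
  supp :: "nat \<Rightarrow> nat set"
  coef :: "nat \<Rightarrow> nat \<Rightarrow> real"

definition valid_cip :: "cip \<Rightarrow> bool" where
  "valid_cip P \<longleftrightarrow>
     (\<forall>i\<in>{1..nvars P}. cost P i > 0 \<and> ub P i > 0) \<and>
     (\<forall>j\<in>{1..ncons P}. supp P j \<subseteq> {1..nvars P} \<and>
        (\<forall>i\<in>supp P j. coef P i j > 0) \<and>
        (\<forall>i. i \<notin> supp P j \<longrightarrow> coef P i j = 0))"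

definition objective :: "cip \<Rightarrow> (nat \<Rightarrow> real) \<Rightarrow> real" where
  "objective P x = (\<Sum>i\<in>{1..nvars P}. cost P i * x i)"

text \<open>Feasibility with respect to the first \<open>m\<close> constraints only.\<close>

definition lp_feasible :: "cip \<Rightarrow> nat \<Rightarrow> (nat \<Rightarrow> real) \<Rightarrow> bool" where
  "lp_feasible P m x \<longleftrightarrow>
     (\<forall>i\<in>{1..nvars P}. 0 \<le> x i \<and> x i \<le> ub P i) \<and>
     (\<forall>j\<in>{1..m}. (\<Sum>i\<in>supp P j. coef P i j * x i) \<ge> 1)"

definition ip_feasible :: "cip \<Rightarrow> nat \<Rightarrow> (nat \<Rightarrow> real) \<Rightarrow> bool" where
  "ip_feasible P m x \<longleftrightarrow> lp_feasible P m x \<and> (\<forall>i\<in>{1..nvars P}. x i \<in> \<int>)"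

definition opt_ip :: "cip \<Rightarrow> nat \<Rightarrow> real" where
  "opt_ip P m = Inf (objective P ` {x. ip_feasible P m x})"

text \<open>
  A state of the algorithm.  \<open>arrived\<close> is the index \<open>j\<close> of the latest constraint, \<open>F\<^sub>j\<close> is held in
  \<open>saturated\<close>, \<open>h\<close> in \<open>stage\<close>, and \<open>t\<^sub>h\<close>, \<open>T\<^sub>h\<close>, \<open>\<alpha>\<^sub>i\<^sub>h\<close> in \<open>dual s h\<close>, \<open>active s h\<close>, \<open>alpha s i h\<close>.
  In phase \<open>Waiting\<close> constraints \<open>1..arrived\<close> have been processed; in phase \<open>Covering\<close> the
  while loop for constraint \<open>arrived\<close> is being executed.
\<close>

datatype phase = Waiting | Covering | Infeasible

record state =
  phase :: phase
  arrived :: nat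
  param :: nat
  val :: "nat \<Rightarrow> real"
  stage :: nat
  dual :: "nat \<Rightarrow> real"
  saturated :: "nat set"
  active :: "nat \<Rightarrow> nat set"
  alpha :: "nat \<Rightarrow> nat \<Rightarrow> real"

text \<open>The value of \<open>param\<close> before the first arrival is never read by the algorithm.\<close>

definition init_state :: state where
  "init_state = \<lparr> phase = Waiting, arrived = 0, param = 2, val = (\<lambda>_. 0), stage = 0,
     dual = (\<lambda>_. 0), saturated = {}, active = (\<lambda>_. {}), alpha = (\<lambda>_ _. 0) \<rparr>"

definition sparsity_param :: "cip \<Rightarrow> nat \<Rightarrow> nat" where
  "sparsity_param P j =
     (LEAST k. (\<exists>e. k = 2 ^ e) \<and> Max (insert 2 ((\<lambda>r. card (supp P r)) ` {1..j})) \<le> k)"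

text \<open>Incrementing \<open>h\<close> and recomputing \<open>T\<^sub>h\<close>, \<open>b\<close> and \<open>\<alpha>\<^sub>i\<^sub>h\<close> from the current \<open>F\<^sub>j\<close>.\<close>

definition open_stage :: "cip \<Rightarrow> state \<Rightarrow> state" where
  "open_stage P s =
     (let j = arrived s; F = saturated s; h = Suc (stage s); T = supp P j - F;
          b = 1 - (\<Sum>i\<in>F. coef P i j * ub P i)
      in s \<lparr> stage := h,
             dual := (dual s)(h := 0),
             active := (active s)(h := T),
             alpha := (\<lambda>i. (alpha s i)(h := (if i \<in> T then min 1 (coef P i j / b) else 0))),
             phase := (if b \<le> 0 then Waiting else Covering) \<rparr>)"

definition arrive :: "cip \<Rightarrow> real \<Rightarrow> state \<Rightarrow> state" where
  "arrive P \<tau> s =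
     (let j = Suc (arrived s)
      in open_stage P (s \<lparr> arrived := j,
                           param := sparsity_param P j,
                           saturated := {i \<in> supp P j. val s i \<ge> \<tau> * ub P i} \<rparr>))"

definition unit_cost :: "cip \<Rightarrow> state \<Rightarrow> nat \<Rightarrow> real" where
  "unit_cost P s i = cost P i / alpha s i (stage s)"

definition min_unit_cost :: "cip \<Rightarrow> state \<Rightarrow> real" where
  "min_unit_cost P s = Min (unit_cost P s ` active s (stage s))"

definition raised :: "cip \<Rightarrow> state \<Rightarrow> real \<Rightarrow> nat \<Rightarrow> real" where
  "raised P s \<delta> i =
     (1 + \<delta> * (min_unit_cost P s / unit_cost P s i)) * val s i
     + \<delta> / (real (param s) * alpha s i (stage s)) * (min_unit_cost P s / unit_cost P s i)"

definition step_length :: "cip \<Rightarrow> real \<Rightarrow> state \<Rightarrow> real" where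
  "step_length P \<tau> s =
     (GREATEST \<delta>. 0 < \<delta> \<and> \<delta> \<le> 1 \<and> (\<forall>i\<in>active s (stage s). raised P s \<delta> i \<le> \<tau> * ub P i))"

definition raise :: "cip \<Rightarrow> real \<Rightarrow> state \<Rightarrow> state" where
  "raise P \<tau> s =
     (let h = stage s; T = active s h; \<delta> = step_length P \<tau> s;
          x = (\<lambda>i. if i \<in> T then raised P s \<delta> i else val s i);
          F' = {i \<in> T. x i = \<tau> * ub P i};
          s' = s \<lparr> val := x,
                   dual := (dual s)(h := dual s h + \<delta>),
                   saturated := saturated s \<union> F' \<rparr>
      in if F' \<noteq> {} then open_stage P s' else s')"

text \<open>
  One transition: the arrival of a constraint (with everything up to the while loop), or one
  evaluation of the loop guard together with the iteration it triggers.  The state stays put once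
  all constraints have been processed, or after the output \<open>Infeasible\<close>.
\<close>

definition step :: "cip \<Rightarrow> real \<Rightarrow> state \<Rightarrow> state" where
  "step P \<tau> s =
     (case phase s of
        Waiting \<Rightarrow> if arrived s < ncons P then arrive P \<tau> s else s
      | Infeasible \<Rightarrow> s
      | Covering \<Rightarrow>
          (let h = stage s; T = active s h
           in if (\<Sum>i\<in>T. alpha s i h * val s i) < 1
              then (if T = {} then s \<lparr> phase := Infeasible \<rparr> else raise P \<tau> s)
              else s \<lparr> phase := Waiting \<rparr>))"

definition run :: "cip \<Rightarrow> real \<Rightarrow> nat \<Rightarrow> state" where
  "run P \<tau> t = (step P \<tau> ^^ t) init_state"

definition processed :: "cip \<Rightarrow> real \<Rightarrow> nat \<Rightarrow> nat \<Rightarrow> bool" where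
  "processed P \<tau> m t \<longleftrightarrow> phase (run P \<tau> t) = Waiting \<and> arrived (run P \<tau> t) = m"

definition val_after :: "cip \<Rightarrow> real \<Rightarrow> nat \<Rightarrow> nat \<Rightarrow> real" where
  "val_after P \<tau> j = val (run P \<tau> (LEAST t. processed P \<tau> j t))"

definition round_up :: "cip \<Rightarrow> real \<Rightarrow> (nat \<Rightarrow> real) \<Rightarrow> nat \<Rightarrow> real" where
  "round_up P \<tau> x i = (if x i < \<tau> * ub P i then x i else ub P i)"

definition heavy :: "cip \<Rightarrow> real \<Rightarrow> nat \<Rightarrow> nat set" where
  "heavy P \<tau> j = {i \<in> {1..nvars P}. val_after P \<tau> j i \<ge> \<tau> * ub P i}"

definition full_coverage :: "cip \<Rightarrow> nat \<Rightarrow> nat set \<Rightarrow> real" where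
  "full_coverage P j H = (\<Sum>r\<in>H. coef P r j * ub P r)"

end

(*
  The cost of the algorithm is compared with an arbitrary integral solution z through the potential
    4 * sum_i c_i z_i log2 (1 + K min (x_i, 5 z_i) / z_i),   K >= k,
  which never exceeds 16 log2 K times the cost of z.  An iteration with step length delta costs at
  most 2 delta d_m.  Integrality of z gives the knapsack cover inequality
  sum_{T_h} min (1, alpha_ih z_i) >= 1, whereas sum_{T_h} alpha_ih x_i < 1; hence the indices with
  x_i < 2 z_i contribute at least 1/2 to the former sum, and on these the potential gains what the
  iteration costs.  Truncating alpha_ih z_i at 1 is what makes the bound independent of how much
  alpha_ih varies from stage to stage.  Every iteration saturates a variable or, with delta = 1,
  raises the cheapest variable by at least 1/k, so each while loop ends.
*)
theory Submission
  imports Defs "HOL-Analysis.Convex"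
begin

section \<open>The logarithmic potential and the cost of one iteration\<close>

text \<open>At \<open>z = 0\<close> division by zero makes the value \<open>0\<close>.\<close>

definition gain :: "real \<Rightarrow> real \<Rightarrow> real \<Rightarrow> real" where
  "gain K z x = z * log 2 (1 + K * min x (5 * z) / z)"

lemma gain_mono:
  assumes "0 \<le> K" "0 \<le> z" "0 \<le> x" "x \<le> y"
  shows "gain K z x \<le> gain K z y"
proof (cases "z = 0")
  case False
  then have z: "z > 0" using assms by simp
  have "K * min x (5 * z) / z \<le> K * min y (5 * z) / z"
    using assms z by (intro divide_right_mono mult_left_mono) auto
  moreover have "0 \<le> K * min x (5 * z) / z"
    using assms z by simp
  ultimately have "log 2 (1 + K * min x (5 * z) / z) \<le> log 2 (1 + K * min y (5 * z) / z)"
    by simp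
  then show ?thesis
    unfolding gain_def using z by (intro mult_left_mono) auto
qed (simp add: gain_def)

lemma gain_nonneg:
  assumes "0 \<le> K" "0 \<le> z" "0 \<le> x"
  shows "0 \<le> gain K z x"
proof -
  have "0 \<le> K * min x (5 * z) / z" using assms by simp
  then have "0 \<le> log 2 (1 + K * min x (5 * z) / z)" by simp
  then show ?thesis unfolding gain_def using assms by simp
qed

text \<open>Truncating at \<open>5 * z\<close> bounds the argument of the logarithm by
  \<open>1 + 5 * K\<close>, and for \<open>K\<close> at least 2 this is at most
  \<open>8 * K\<close>, hence at most \<open>K ^ 4\<close>; the exponent is the factor 4.\<close>

lemma gain_le:
  assumes "2 \<le> K" "0 \<le> z" "0 \<le> x"
  shows "gain K z x \<le> 4 * log 2 K * z"
proof (cases "z = 0")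
  case False
  then have z: "z > 0" using assms by simp
  have "K * min x (5 * z) / z \<le> K * (5 * z) / z"
    using assms z by (intro divide_right_mono mult_left_mono) auto
  then have "1 + K * min x (5 * z) / z \<le> 1 + 5 * K"
    using z by simp
  also have "\<dots> \<le> 8 * K" using assms by simp
  also have "\<dots> \<le> K ^ 3 * K"
    using power_mono[of 2 K 3] assms by (intro mult_right_mono) auto
  also have "\<dots> = K ^ 4" by (simp add: eval_nat_numeral)
  finally have "1 + K * min x (5 * z) / z \<le> K ^ 4" .
  moreover have "0 \<le> K * min x (5 * z) / z" using assms z by simp
  ultimately have "log 2 (1 + K * min x (5 * z) / z) \<le> log 2 (K ^ 4)"
    by (intro log_mono) auto
  also have "\<dots> = 4 * log 2 K" using assms by (simp add: log_nat_power)
  finally show ?thesis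
    unfolding gain_def using z by (simp add: mult.commute)
qed (simp add: gain_def)

text \<open>The two sides agree at 0 and at 1, so concavity of the logarithm puts the chord below
  the graph in between.\<close>

lemma le_log2_one_plus:
  fixes s :: real
  assumes "0 \<le> s" "s \<le> 1"
  shows "s \<le> log 2 (1 + s)"
proof -
  have "(1 - s) * ln 1 + s * ln 2 \<le> ln ((1 - s) *\<^sub>R 1 + s *\<^sub>R (2::real))"
    using assms by (intro concave_onD[OF ln_concave]) auto
  then have "s * ln 2 \<le> ln (1 + s)" by (simp add: algebra_simps)
  then show ?thesis by (simp add: log_def field_simps)
qed

text \<open>Below the truncation point the difference of logarithms is \<open>log 2 (1 + s)\<close>,
  where \<open>s\<close> is the relative growth of \<open>x + z / K\<close>. Linearizing it by the
  chord bound leaves \<open>z * s\<close>, and capping \<open>1 / a\<close> by \<open>z\<close>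
  keeps \<open>s\<close> at most 1.\<close>

lemma gain_increase:
  assumes k: "1 \<le> k" "k \<le> K" and e: "0 \<le> e" "e \<le> 1" and a: "0 < a"
    and x: "0 \<le> x" "x < 2 * z"
  shows "e * min (1 / a) z \<le> gain K z (x + e * (x + 1 / (k * a))) - gain K z x"
proof -
  define w where "w = min (1 / a) z"
  \<comment> \<open>A smaller increase than the actual one, with \<open>w / K\<close> in place of
    \<open>1 / (k * a)\<close>; monotonicity of \<open>gain\<close> transfers the estimate at the
    end.\<close>
  define y where "y = x + e * (x + w / K)"
  have z: "z > 0" using x by simp
  have K: "K > 0" using k by simp
  have w: "0 < w" "w \<le> z" "w \<le> 1 / a" using a z by (auto simp: w_def)
  have "w / K \<le> (1 / a) / k"
    using w k a by (intro frac_le) auto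
  then have "w / K \<le> 1 / (k * a)" by (simp add: field_simps)
  then have y_le: "y \<le> x + e * (x + 1 / (k * a))"
    unfolding y_def using e by (intro add_left_mono mult_left_mono) auto
  have K1: "0 \<le> x + w / K" using x w K by simp
  have xy: "x \<le> y" unfolding y_def using e K1 by simp
  define s where "s = e * ((x + w / K) / (x + z / K))"
  have den: "0 < x + z / K" using x z K by (simp add: add_nonneg_pos)
  have "w / K \<le> z / K" using w K by (simp add: divide_right_mono)
  then have frac1: "(x + w / K) / (x + z / K) \<le> 1" using den by simp
  have s0: "0 \<le> s" unfolding s_def using e K1 den by simp
  have s1: "s \<le> 1" unfolding s_def using e frac1 K1 den
    by (intro mult_le_one) auto
  \<comment> \<open>Since \<open>w\<close> is at most \<open>z\<close>, the fraction in
    \<open>s\<close> is at least \<open>w / z\<close>; so the chord bound yields at least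
    \<open>e * w\<close>.\<close>
  have "w * x \<le> z * x" using w x by (intro mult_right_mono) auto
  then have "w * (x + z / K) \<le> z * (x + w / K)"
    by (simp add: algebra_simps)
  then have "w \<le> z * ((x + w / K) / (x + z / K))"
    using den by (simp add: field_simps)
  then have "e * w \<le> e * (z * ((x + w / K) / (x + z / K)))"
    using e by (intro mult_left_mono)
  also have "\<dots> = z * s" by (simp add: s_def)
  also have "\<dots> \<le> z * log 2 (1 + s)"
    using le_log2_one_plus[OF s0 s1] z by (intro mult_left_mono) auto
  also have "1 + s = (1 + K * y / z) / (1 + K * x / z)"
  proof -
    have "1 + s = (y + z / K) / (x + z / K)"
      using den by (simp add: s_def y_def add_divide_distrib[symmetric] field_simps)
    also have "\<dots> = (K / z * (y + z / K)) / (K / z * (x + z / K))"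
      using K z by simp
    also have "\<dots> = (1 + K * y / z) / (1 + K * x / z)"
      using K z by (simp add: algebra_simps)
    finally show ?thesis .
  qed
  also have "log 2 \<dots> = log 2 (1 + K * y / z) - log 2 (1 + K * x / z)"
  proof -
    have "0 \<le> K * y / z" "0 \<le> K * x / z" using xy x K z by auto
    then have "0 < 1 + K * y / z" "0 < 1 + K * x / z" by linarith+
    then show ?thesis by (simp add: log_divide)
  qed
  \<comment> \<open>This fixes the constant 5: \<open>y\<close> is at most
    \<open>2 * x + w / K\<close>, hence at most \<open>4 * z + z\<close>, so neither
    \<open>x\<close> nor \<open>y\<close> is truncated.\<close>
  also have "z * \<dots> = gain K z y - gain K z x"
  proof -
    have "e * (x + w / K) \<le> x + w / K"
      using e K1 by (simp add: mult_left_le_one_le)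
    moreover have "z / K \<le> z" using k z by (simp add: field_simps)
    ultimately have "y \<le> 5 * z"
      using x \<open>w / K \<le> z / K\<close> unfolding y_def by linarith
    then show ?thesis using x by (simp add: gain_def algebra_simps)
  qed
  also have "gain K z y \<le> gain K z (x + e * (x + 1 / (k * a)))"
    using y_le xy x z K by (intro gain_mono) auto
  finally show ?thesis by (simp add: w_def)
qed

text \<open>The constant 4 compares two estimates: the cost is at most
  \<open>2 * (\<delta> * d)\<close>, while the weighted gain is at least half of
  \<open>\<delta> * d\<close>.\<close>

lemma covering_step_cost:
  assumes T: "finite T" "real (card T) \<le> k" and k: "1 \<le> k" "k \<le> K"
    and pos: "\<And>i. i \<in> T \<Longrightarrow> 0 < a i" "\<And>i. i \<in> T \<Longrightarrow> 0 < c i"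
      "\<And>i. i \<in> T \<Longrightarrow> 0 \<le> x i" "\<And>i. i \<in> T \<Longrightarrow> 0 \<le> z i"
    and d: "0 \<le> d" "\<And>i. i \<in> T \<Longrightarrow> d \<le> c i / a i"
    and delta: "0 \<le> \<delta>" "\<delta> \<le> 1"
    and uncovered: "(\<Sum>i\<in>T. a i * x i) < 1"
    and covered: "1 \<le> (\<Sum>i\<in>T. min 1 (a i * z i))"
    and y: "\<And>i. i \<in> T \<Longrightarrow> y i = x i + \<delta> * (d / (c i / a i)) * (x i + 1 / (k * a i))"
  shows "(\<Sum>i\<in>T. c i * (y i - x i)) \<le> 4 * (\<Sum>i\<in>T. c i * (gain K (z i) (y i) - gain K (z i) (x i)))"
proof -
  define S where "S = {i \<in> T. x i < 2 * z i}"
  \<comment> \<open>The rate is inversely proportional to \<open>c i / a i\<close>, so the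
    individual cost cancels and every index pays at the same price \<open>d\<close>.\<close>
  have eq: "c i * (y i - x i) = \<delta> * d * (a i * x i + 1 / k)" if "i \<in> T" for i
  proof -
    have "c i * (y i - x i) = c i * (\<delta> * (d * a i / c i) * (x i + 1 / (k * a i)))"
      using y[OF that] by simp
    also have "\<dots> = \<delta> * d * (a i * (x i + 1 / (k * a i)))"
      using pos(2)[OF that] by simp
    also have "a i * (x i + 1 / (k * a i)) = a i * x i + 1 / k"
      using pos(1)[OF that] by (simp add: distrib_left)
    finally show ?thesis .
  qed
  have xy: "x i \<le> y i" if "i \<in> T" for i
    using y[OF that] pos(1-3)[OF that] k d(1) delta by simp
  have "(\<Sum>i\<in>T. c i * (y i - x i)) = \<delta> * d * ((\<Sum>i\<in>T. a i * x i) + card T / k)"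
    using eq by (simp add: sum_distrib_left[symmetric] sum.distrib)
  also have "\<dots> \<le> \<delta> * d * 2"
  proof (intro mult_left_mono)
    have "card T / k \<le> 1" using T(2) k by simp
    then show "(\<Sum>i\<in>T. a i * x i) + card T / k \<le> 2" using uncovered by linarith
  qed (use d(1) delta in simp)
  finally have cost: "(\<Sum>i\<in>T. c i * (y i - x i)) \<le> 2 * (\<delta> * d)" by simp
  \<comment> \<open>Outside \<open>S\<close> the value \<open>z i\<close> is at most half of
    \<open>x i\<close>; by the loop guard these indices carry less than 1/2 of the cover.\<close>
  have "min 1 (a i * z i) \<le> a i * x i / 2" if "i \<in> T - S" for i
  proof -
    have "a i * (2 * z i) \<le> a i * x i"
      using that pos(1)[of i] by (intro mult_left_mono) (auto simp: S_def)
    then show ?thesis by simp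
  qed
  then have "(\<Sum>i\<in>T - S. min 1 (a i * z i)) \<le> (\<Sum>i\<in>T - S. a i * x i / 2)"
    by (rule sum_mono)
  also have "\<dots> \<le> (\<Sum>i\<in>T. a i * x i / 2)"
    using T pos by (intro sum_mono2) (auto simp: less_imp_le)
  also have "\<dots> < 1 / 2"
    using uncovered by (simp add: sum_divide_distrib[symmetric])
  finally have "1 / 2 \<le> (\<Sum>i\<in>S. min 1 (a i * z i))"
    using covered sum.subset_diff[of S T "\<lambda>i. min 1 (a i * z i)"] T by (auto simp: S_def)
  then have "\<delta> * d * (1 / 2) \<le> \<delta> * d * (\<Sum>i\<in>S. min 1 (a i * z i))"
    using d(1) delta by (intro mult_left_mono) auto
  also have "\<dots> = (\<Sum>i\<in>S. \<delta> * d * min 1 (a i * z i))"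
    by (simp add: sum_distrib_left)
  also have "\<dots> \<le> (\<Sum>i\<in>S. c i * (gain K (z i) (y i) - gain K (z i) (x i)))"
  proof (rule sum_mono)
    fix i assume "i \<in> S"
    then have i: "i \<in> T" "x i < 2 * z i" by (auto simp: S_def)
    define e where "e = \<delta> * (d / (c i / a i))"
    have "d / (c i / a i) \<le> 1" "0 \<le> d / (c i / a i)"
      using d(1) d(2)[OF i(1)] pos[OF i(1)] by (simp_all add: field_simps)
    then have e: "0 \<le> e" "e \<le> 1"
      unfolding e_def using delta by (auto intro: mult_nonneg_nonneg mult_le_one simp del: divide_divide_eq_right times_divide_eq_right)
    \<comment> \<open>Pulling out \<open>a i\<close> produces the minimum in
      \<open>gain_increase\<close>, and \<open>c i * e\<close> equals
      \<open>\<delta> * d * a i\<close>.\<close>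
    have "min 1 (a i * z i) = a i * min (1 / a i) (z i)"
      using pos(1)[OF i(1)] by (simp add: min_def field_simps)
    then have "\<delta> * d * min 1 (a i * z i) = c i * (e * min (1 / a i) (z i))"
      using pos[OF i(1)] by (simp add: e_def)
    also have "\<dots> \<le> c i * (gain K (z i) (y i) - gain K (z i) (x i))"
      using gain_increase[OF k e pos(1)[OF i(1)] pos(3)[OF i(1)] i(2)] pos(2)[OF i(1)] y[OF i(1)]
      by (intro mult_left_mono) (auto simp: e_def)
    finally show "\<delta> * d * min 1 (a i * z i) \<le> c i * (gain K (z i) (y i) - gain K (z i) (x i))" .
  qed
  \<comment> \<open>Indices outside \<open>S\<close> only add to the right-hand side, since no
    variable decreases and \<open>gain\<close> is monotone.\<close>
  also have "\<dots> \<le> (\<Sum>i\<in>T. c i * (gain K (z i) (y i) - gain K (z i) (x i)))"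
    using T pos xy k by (intro sum_mono2) (auto simp: S_def less_imp_le intro!: mult_nonneg_nonneg gain_mono)
  finally show ?thesis using cost by simp
qed

section \<open>The sparsity parameter and the opening of a stage\<close>

lemma sparsity_param_ge_Max:
  "Max (insert 2 ((\<lambda>r. card (supp P r)) ` {1..j})) \<le> sparsity_param P j" (is "?M \<le> _")
proof -
  \<comment> \<open>Powers of 2 are unbounded, so the \<open>LEAST\<close> in the definition is
    attained.\<close>
  have "\<exists>k. (\<exists>e. k = 2 ^ e) \<and> ?M \<le> k"
    using less_exp[of ?M] less_imp_le by blast
  from LeastI_ex[OF this] show ?thesis
    unfolding sparsity_param_def by blast
qed

lemma sparsity_param_ge_2: "2 \<le> sparsity_param P j"
  using sparsity_param_ge_Max[of P j] by simp

lemma card_supp_le_sparsity_param: "1 \<le> j \<Longrightarrow> card (supp P j) \<le> sparsity_param P j"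
  using sparsity_param_ge_Max[of P j] by simp

lemma sparsity_param_mono:
  assumes "j \<le> j'" shows "sparsity_param P j \<le> sparsity_param P j'"
proof -
  have "\<exists>e. sparsity_param P j' = 2 ^ e"
  proof -
    have "\<exists>k. (\<exists>e. k = 2 ^ e) \<and> Max (insert 2 ((\<lambda>r. card (supp P r)) ` {1..j'})) \<le> k"
      using less_exp less_imp_le by blast
    from LeastI_ex[OF this] show ?thesis
      unfolding sparsity_param_def by blast
  qed
  moreover have "Max (insert 2 ((\<lambda>r. card (supp P r)) ` {1..j}))
      \<le> Max (insert 2 ((\<lambda>r. card (supp P r)) ` {1..j'}))"
    using assms by (intro Max_mono) auto
  \<comment> \<open>The power of 2 chosen for \<open>j'\<close> is also a candidate in the minimum
    for \<open>j\<close>.\<close>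
  ultimately show ?thesis
    using sparsity_param_ge_Max[of P j']
    by (subst sparsity_param_def[of P j], intro Least_le) (metis order_trans)
qed

text \<open>Agrees with the value 2 in \<open>init_state\<close>, so the invariant on
  \<open>param\<close> holds from the start.\<close>

lemma sparsity_param_0: "sparsity_param P 0 = 2"
  unfolding sparsity_param_def
  by (intro Least_equality) (auto intro: exI[of _ "1::nat"])

text \<open>Here \<open>b\<close> is expressed through \<open>full_coverage\<close>. Only the
  entries of the new stage are recorded, because the invariants refer to the current stage
  alone.\<close>

lemma open_stage_simps [simp]:
  "val (open_stage P s) = val s"
  "arrived (open_stage P s) = arrived s"
  "param (open_stage P s) = param s"
  "saturated (open_stage P s) = saturated s"
  "stage (open_stage P s) = Suc (stage s)"
  "active (open_stage P s) (Suc (stage s)) = supp P (arrived s) - saturated s"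
  "phase (open_stage P s) =
     (if 1 - full_coverage P (arrived s) (saturated s) \<le> 0 then Waiting else Covering)"
  "alpha (open_stage P s) i (Suc (stage s)) = (if i \<in> supp P (arrived s) - saturated s
     then min 1 (coef P i (arrived s) / (1 - full_coverage P (arrived s) (saturated s))) else 0)"
  by (simp_all add: open_stage_def Let_def full_coverage_def)

section \<open>Invariants of a run on a feasible instance\<close>

locale feasible_run =
  fixes P :: cip and \<tau> :: real
  assumes valid: "valid_cip P"
    and tau: "0 < \<tau>" "\<tau> < 1/2"
    and feasible: "\<exists>z. ip_feasible P (ncons P) z"
begin

text \<open>Counterpart of \<open>heavy\<close> for an arbitrary vector, confined to the support so
  that it can be equated with \<open>saturated\<close>. Both sets give the same coverage, as
  coefficients vanish off the support.\<close>

definition heavy_supp :: "nat \<Rightarrow> (nat \<Rightarrow> real) \<Rightarrow> nat set" where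
  "heavy_supp j x = {i \<in> supp P j. \<tau> * ub P i \<le> x i}"

definition residual :: "nat \<Rightarrow> (nat \<Rightarrow> real) \<Rightarrow> real" where
  "residual j x = 1 - full_coverage P j (heavy_supp j x)"

definition knapsack_covered :: "nat \<Rightarrow> (nat \<Rightarrow> real) \<Rightarrow> bool" where
  "knapsack_covered j x \<longleftrightarrow> (0 < residual j x \<longrightarrow>
     residual j x \<le> (\<Sum>i\<in>supp P j - heavy_supp j x. min (coef P i j) (residual j x) * x i))"

text \<open>The upper bound is the threshold, not \<open>ub\<close>: a step stops when some variable
  reaches the threshold, and that variable is not raised again.\<close>

definition in_box :: "(nat \<Rightarrow> real) \<Rightarrow> bool" where
  "in_box x \<longleftrightarrow> (\<forall>i\<in>{1..nvars P}. 0 \<le> x i \<and> x i \<le> \<tau> * ub P i)"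

definition lp_covered :: "nat \<Rightarrow> (nat \<Rightarrow> real) \<Rightarrow> bool" where
  "lp_covered j x \<longleftrightarrow> 1 \<le> (\<Sum>i\<in>supp P j. coef P i j * round_up P \<tau> x i)"

text \<open>The cost bound ranges over all \<open>K\<close> from the current parameter upwards, so
  it survives a growth of the parameter, and over all solutions of the arrived constraints, a set
  that only shrinks. Coverage leaves out the constraint being processed.\<close>

definition well_formed :: "state \<Rightarrow> bool" where
  "well_formed s \<longleftrightarrow> arrived s \<le> ncons P \<and> param s = sparsity_param P (arrived s) \<and>
     in_box (val s) \<and> (\<forall>j\<in>{1..<arrived s}. lp_covered j (val s)) \<and>
     (\<forall>K z. ip_feasible P (arrived s) z \<longrightarrow> real (param s) \<le> K \<longrightarrow>
        objective P (val s) \<le> 4 * (\<Sum>i\<in>{1..nvars P}. cost P i * gain K (z i) (val s i)))"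

text \<open>Ties the stored set and the stored \<open>alpha\<close> to the current vector. This
  holds throughout a stage because the heavy set changes only when a new stage is opened.\<close>

definition covering :: "state \<Rightarrow> bool" where
  "covering s \<longleftrightarrow> 1 \<le> arrived s \<and> saturated s = heavy_supp (arrived s) (val s) \<and>
     active s (stage s) = supp P (arrived s) - saturated s \<and>
     0 < residual (arrived s) (val s) \<and>
     (\<forall>i\<in>active s (stage s). alpha s i (stage s) =
        min 1 (coef P i (arrived s) / residual (arrived s) (val s)))"

definition invar :: "state \<Rightarrow> bool" where
  "invar s \<longleftrightarrow> well_formed s \<and>
     (case phase s of
        Waiting \<Rightarrow> 1 \<le> arrived s \<longrightarrow> knapsack_covered (arrived s) (val s)
      | Covering \<Rightarrow> covering s
      | Infeasible \<Rightarrow> False)"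

section \<open>Valid instances and coverage by the rounded vector\<close>

lemma cost_pos: "i \<in> {1..nvars P} \<Longrightarrow> 0 < cost P i"
  and ub_pos: "i \<in> {1..nvars P} \<Longrightarrow> 0 < ub P i"
  using valid by (auto simp: valid_cip_def)

lemma supp_subset: "j \<in> {1..ncons P} \<Longrightarrow> supp P j \<subseteq> {1..nvars P}"
  and coef_pos: "j \<in> {1..ncons P} \<Longrightarrow> i \<in> supp P j \<Longrightarrow> 0 < coef P i j"
  and coef_zero: "j \<in> {1..ncons P} \<Longrightarrow> i \<notin> supp P j \<Longrightarrow> coef P i j = 0"
  using valid by (auto simp: valid_cip_def)

lemma coef_nonneg: "j \<in> {1..ncons P} \<Longrightarrow> 0 \<le> coef P i j"
  by (metis coef_pos coef_zero less_imp_le order_refl)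

lemma finite_supp: "j \<in> {1..ncons P} \<Longrightarrow> finite (supp P j)"
  using supp_subset finite_subset by blast

lemma heavy_supp_subset: "heavy_supp j x \<subseteq> supp P j"
  by (auto simp: heavy_supp_def)

lemma round_up_mono:
  assumes "i \<in> {1..nvars P}" "x i \<le> y i"
  shows "round_up P \<tau> x i \<le> round_up P \<tau> y i"
proof -
  \<comment> \<open>As \<open>\<tau>\<close> is less than 1, crossing the threshold makes the
    rounded value jump upwards.\<close>
  have "\<tau> * ub P i \<le> ub P i" using tau ub_pos[OF assms(1)] by simp
  then show ?thesis using assms by (auto simp: round_up_def)
qed

text \<open>Lets coverage of earlier constraints persist while later ones raise the vector.\<close>

lemma lp_covered_mono:
  assumes "lp_covered j x" "j \<in> {1..ncons P}" "\<And>i. i \<in> {1..nvars P} \<Longrightarrow> x i \<le> y i"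
  shows "lp_covered j y"
proof -
  have "(\<Sum>i\<in>supp P j. coef P i j * round_up P \<tau> x i) \<le> (\<Sum>i\<in>supp P j. coef P i j * round_up P \<tau> y i)"
    using assms supp_subset[OF assms(2)]
    by (intro sum_mono mult_left_mono round_up_mono coef_nonneg) auto
  then show ?thesis using assms(1) by (simp add: lp_covered_def)
qed

text \<open>Heavy indices, rounded up to their bounds, contribute exactly
  \<open>1 - residual j x\<close>. The light ones supply the rest, since neither removing the cap on
  the coefficients nor rounding decreases their terms.\<close>

lemma knapsack_covered_imp_lp_covered:
  assumes j: "j \<in> {1..ncons P}" and x: "in_box x" and kc: "knapsack_covered j x"
  shows "lp_covered j x"
proof -
  let ?H = "heavy_supp j x" and ?S = "supp P j"
  let ?f = "\<lambda>i. coef P i j * round_up P \<tau> x i"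
  have ub: "x i \<le> round_up P \<tau> x i" if "i \<in> ?S" for i
  proof -
    have i: "i \<in> {1..nvars P}" using that supp_subset[OF j] by auto
    then have "\<tau> * ub P i \<le> ub P i" using tau ub_pos[OF i] by simp
    then show ?thesis using x i by (auto simp: round_up_def in_box_def intro: order_trans)
  qed
  have nonneg: "0 \<le> x i" if "i \<in> ?S" for i
    using that supp_subset[OF j] x by (auto simp: in_box_def)
  have split: "sum ?f ?S = sum ?f (?S - ?H) + sum ?f ?H"
    by (intro sum.subset_diff heavy_supp_subset finite_supp[OF j])
  have H: "sum ?f ?H = 1 - residual j x"
    by (simp add: residual_def full_coverage_def) (auto simp: round_up_def heavy_supp_def intro!: sum.cong)
  have "residual j x \<le> sum ?f (?S - ?H)"
  proof (cases "0 < residual j x")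
    case True
    then have "residual j x \<le> (\<Sum>i\<in>?S - ?H. min (coef P i j) (residual j x) * x i)"
      using kc by (simp add: knapsack_covered_def)
    also have "\<dots> \<le> sum ?f (?S - ?H)"
      using ub nonneg coef_nonneg[OF j] by (intro sum_mono mult_mono) auto
    finally show ?thesis .
  next
    case False
    have "0 \<le> sum ?f (?S - ?H)"
      using ub nonneg coef_nonneg[OF j]
      by (intro sum_nonneg mult_nonneg_nonneg) (auto intro: order_trans)
    then show ?thesis using False by linarith
  qed
  then show ?thesis using split H by (simp add: lp_covered_def)
qed

section \<open>The knapsack cover inequality for integral solutions\<close>

text \<open>If one truncated term reaches 1, it suffices alone. Otherwise integrality makes every
  nonzero \<open>z i\<close> at least 1, so no truncation is active, and the inequality is the
  constraint itself after bounding \<open>z\<close> by \<open>ub\<close> on \<open>F\<close> and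
  dividing by the residual.\<close>

lemma knapsack_cover_integral:
  assumes z: "ip_feasible P m z" and j: "j \<in> {1..m}" "m \<le> ncons P"
    and F: "F \<subseteq> supp P j" and b: "0 < 1 - full_coverage P j F" (is "0 < ?b")
  shows "1 \<le> (\<Sum>i\<in>supp P j - F. min 1 (min 1 (coef P i j / ?b) * z i))"
proof -
  have jn: "j \<in> {1..ncons P}" using j by auto
  note fin = finite_supp[OF jn]
  let ?T = "supp P j - F"
  let ?g = "\<lambda>i. min 1 (min 1 (coef P i j / ?b) * z i)"
  have box: "0 \<le> z i" "z i \<le> ub P i" "z i \<in> \<int>" if "i \<in> supp P j" for i
    using z that supp_subset[OF jn] by (auto simp: ip_feasible_def lp_feasible_def)
  have int: "z i = 0 \<or> 1 \<le> z i" if i: "i \<in> supp P j" for i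
  proof -
    obtain n where n: "z i = of_int n" using box(3)[OF i] by (auto elim: Ints_cases)
    with box(1)[OF i] show ?thesis by auto
  qed
  have nonneg: "0 \<le> ?g i" if "i \<in> ?T" for i
    using that box coef_nonneg[OF jn] b by auto
  show ?thesis
  proof (cases "\<exists>i\<in>?T. 1 \<le> ?g i")
    case True
    then obtain i where i: "i \<in> ?T" "1 \<le> ?g i" by blast
    have "?g i \<le> sum ?g ?T"
      using i nonneg fin by (intro member_le_sum) auto
    then show ?thesis using i by linarith
  next
    case False
    have g: "coef P i j * z i / ?b \<le> ?g i" if i: "i \<in> ?T" for i
    proof (cases "z i = 0")
      case zi: False
      then have "1 \<le> z i" using int i by auto
      define r where "r = coef P i j / ?b"
      have "min 1 (min 1 r * z i) < 1" using False i unfolding r_def by (meson not_le)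
      then have lt: "min 1 r * z i < 1" by linarith
      \<comment> \<open>For \<open>r\<close> above 1 the product would be \<open>z i\<close>, which
        is at least 1.\<close>
      then have "r \<le> 1" using \<open>1 \<le> z i\<close> by (cases "r \<le> 1") simp_all
      then have "r * z i \<le> min 1 (min 1 r * z i)" using lt by simp
      then show ?thesis by (simp add: r_def)
    qed simp
    have "1 \<le> (\<Sum>i\<in>supp P j. coef P i j * z i)"
      using z j by (auto simp: ip_feasible_def lp_feasible_def)
    also have "\<dots> = (\<Sum>i\<in>?T. coef P i j * z i) + (\<Sum>i\<in>F. coef P i j * z i)"
      by (intro sum.subset_diff F fin)
    also have "(\<Sum>i\<in>F. coef P i j * z i) \<le> full_coverage P j F"
      unfolding full_coverage_def using box F coef_nonneg[OF jn]
      by (intro sum_mono mult_left_mono) auto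
    finally have "?b \<le> (\<Sum>i\<in>?T. coef P i j * z i)" by simp
    then have "1 \<le> (\<Sum>i\<in>?T. coef P i j * z i) / ?b" using b by simp
    also have "\<dots> = (\<Sum>i\<in>?T. coef P i j * z i / ?b)" by (simp add: sum_divide_distrib)
    also have "\<dots> \<le> sum ?g ?T" using g by (rule sum_mono)
    finally show ?thesis .
  qed
qed

section \<open>Arrivals and new stages\<close>

text \<open>With a nonpositive residual the phase becomes \<open>Waiting\<close> and
  \<open>knapsack_covered\<close> is vacuous; otherwise the freshly computed entries are what
  \<open>covering\<close> demands.\<close>

lemma invar_open_stage:
  assumes "well_formed s" "1 \<le> arrived s" "saturated s = heavy_supp (arrived s) (val s)"
  shows "invar (open_stage P s)"
proof -
  have "well_formed (open_stage P s)" using assms(1) by (simp add: well_formed_def)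
  then show ?thesis
    using assms(2,3)
    by (simp add: invar_def covering_def knapsack_covered_def residual_def)
qed

lemma waiting_lp_covered:
  assumes "invar s" "phase s = Waiting" "j \<in> {1..arrived s}"
  shows "lp_covered j (val s)"
proof (cases "j = arrived s")
  case True
  then show ?thesis
    using assms by (intro knapsack_covered_imp_lp_covered) (auto simp: invar_def well_formed_def)
next
  case False
  then show ?thesis using assms by (auto simp: invar_def well_formed_def)
qed

lemma invar_arrive:
  assumes inv: "invar s" and w: "phase s = Waiting" and lt: "arrived s < ncons P"
  shows "invar (arrive P \<tau> s)"
proof -
  have wf: "well_formed s" using inv by (simp add: invar_def)
  let ?j = "Suc (arrived s)"
  define s' where "s' = s \<lparr> arrived := ?j, param := sparsity_param P ?j,
    saturated := {i \<in> supp P ?j. val s i \<ge> \<tau> * ub P i} \<rparr>"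
  have "ip_feasible P (arrived s) z" if "ip_feasible P ?j z" for z
    using that by (auto simp: ip_feasible_def lp_feasible_def)
  moreover have "param s \<le> sparsity_param P ?j"
    using wf sparsity_param_mono[of "arrived s" ?j P] by (simp add: well_formed_def)
  ultimately have "well_formed s'"
    using wf lt waiting_lp_covered[OF inv w]
    by (auto simp: well_formed_def s'_def less_Suc_eq_le)
  then have "invar (open_stage P s')"
    by (rule invar_open_stage) (auto simp: s'_def heavy_supp_def)
  then show ?thesis by (simp add: arrive_def s'_def)
qed

section \<open>One raising iteration of the while loop\<close>

definition lifted :: "state \<Rightarrow> nat \<Rightarrow> real" where
  "lifted s i = (if i \<in> active s (stage s) then raised P s (step_length P \<tau> s) i else val s i)"

definition newly_saturated :: "state \<Rightarrow> nat set" where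
  "newly_saturated s = {i \<in> active s (stage s). lifted s i = \<tau> * ub P i}"

text \<open>The intermediate state inside \<open>raise\<close>, before a possible new stage; naming
  it allows \<open>well_formed\<close> to be proved once for both outcomes.\<close>

definition lift_state :: "state \<Rightarrow> state" where
  "lift_state s = s \<lparr> val := lifted s,
     dual := (dual s)(stage s := dual s (stage s) + step_length P \<tau> s),
     saturated := saturated s \<union> newly_saturated s \<rparr>"

lemma raise_eq:
  "raise P \<tau> s = (if newly_saturated s \<noteq> {} then open_stage P (lift_state s) else lift_state s)"
  by (auto simp: raise_def Let_def lift_state_def lifted_def[abs_def] newly_saturated_def)

lemma lift_state_simps [simp]:
  "val (lift_state s) = lifted s"
  "arrived (lift_state s) = arrived s"
  "param (lift_state s) = param s"
  "phase (lift_state s) = phase s"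
  "stage (lift_state s) = stage s"
  "active (lift_state s) = active s"
  "alpha (lift_state s) = alpha s"
  "saturated (lift_state s) = saturated s \<union> newly_saturated s"
  by (simp_all add: lift_state_def)

lemma raise_simps [simp]:
  "val (raise P \<tau> s) = lifted s"
  "arrived (raise P \<tau> s) = arrived s"
  "param (raise P \<tau> s) = param s"
  "saturated (raise P \<tau> s) = saturated s \<union> newly_saturated s"
  by (simp_all add: raise_eq)

context
  fixes s assumes inv: "invar s" and cov: "phase s = Covering"
begin

lemma wf_state: "well_formed s" and covering_state: "covering s"
  using inv cov by (simp_all add: invar_def)

lemma arrived_in: "arrived s \<in> {1..ncons P}"
  using wf_state covering_state by (auto simp: well_formed_def covering_def)

lemma param_ge_2: "2 \<le> param s"
  using wf_state sparsity_param_ge_2 by (simp add: well_formed_def)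

lemma active_eq: "active s (stage s) = {i \<in> supp P (arrived s). val s i < \<tau> * ub P i}"
  using covering_state by (auto simp: covering_def heavy_supp_def)

lemma finite_active: "finite (active s (stage s))"
  using finite_supp[OF arrived_in] by (simp add: active_eq)

lemma card_active: "card (active s (stage s)) \<le> param s"
proof -
  have "card (active s (stage s)) \<le> card (supp P (arrived s))"
    using finite_supp[OF arrived_in] by (intro card_mono) (auto simp: active_eq)
  also have "\<dots> \<le> param s"
    using wf_state arrived_in card_supp_le_sparsity_param by (simp add: well_formed_def)
  finally show ?thesis .
qed

lemma active_facts:
  assumes i: "i \<in> active s (stage s)"
  shows "i \<in> {1..nvars P}" "val s i < \<tau> * ub P i" "0 \<le> val s i" "0 < cost P i"
    "0 < alpha s i (stage s)" "alpha s i (stage s) \<le> 1" "0 < unit_cost P s i"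
    "min_unit_cost P s \<le> unit_cost P s i"
proof -
  show n: "i \<in> {1..nvars P}" and "val s i < \<tau> * ub P i"
    using i supp_subset[OF arrived_in] by (auto simp: active_eq)
  show "0 \<le> val s i" using n wf_state by (simp add: well_formed_def in_box_def)
  show c: "0 < cost P i" using cost_pos[OF n] .
  have "0 < coef P i (arrived s)"
    using i coef_pos[OF arrived_in] by (simp add: active_eq)
  then show a: "0 < alpha s i (stage s)" "alpha s i (stage s) \<le> 1"
    using covering_state i by (simp_all add: covering_def)
  then show "0 < unit_cost P s i" using c by (simp add: unit_cost_def)
  show "min_unit_cost P s \<le> unit_cost P s i"
    unfolding min_unit_cost_def using i finite_active by (intro Min_le) auto
qed

lemma min_unit_cost_attained:
  assumes "active s (stage s) \<noteq> {}"
  obtains i where "i \<in> active s (stage s)" "unit_cost P s i = min_unit_cost P s"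
proof -
  have "min_unit_cost P s \<in> unit_cost P s ` active s (stage s)"
    unfolding min_unit_cost_def using assms finite_active by (intro Min_in) auto
  then show ?thesis using that by auto
qed

lemma min_unit_cost_pos: "active s (stage s) \<noteq> {} \<Longrightarrow> 0 < min_unit_cost P s"
  by (metis min_unit_cost_attained active_facts(7))

text \<open>The derivative of \<open>raised\<close> in the step length. By \<open>raised_eq\<close>
  the dependence is affine, so each threshold is an upper bound on the step length.\<close>

definition slope :: "nat \<Rightarrow> real" where
  "slope i = min_unit_cost P s / unit_cost P s i * (val s i + 1 / (param s * alpha s i (stage s)))"

lemma raised_eq: "raised P s \<delta> i = val s i + \<delta> * slope i"
  by (simp add: raised_def slope_def algebra_simps)

lemma slope_pos:
  assumes "i \<in> active s (stage s)" shows "0 < slope i"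
proof -
  have "0 < 1 / (param s * alpha s i (stage s))"
    using param_ge_2 active_facts(5)[OF assms] by simp
  then have "0 < val s i + 1 / (param s * alpha s i (stage s))"
    using active_facts(3)[OF assms] by linarith
  moreover have "0 < min_unit_cost P s" using assms min_unit_cost_pos by auto
  ultimately show ?thesis
    unfolding slope_def using active_facts(7)[OF assms] by simp
qed

text \<open>The \<open>GREATEST\<close> exists because the admissible step lengths are bounded by
  finitely many positive numbers, whose minimum is admissible. Hence a step is either full or
  saturates a variable.\<close>

lemma step_length_facts:
  shows step_length_pos: "0 < step_length P \<tau> s" and step_length_le_1: "step_length P \<tau> s \<le> 1"
    and raised_le: "\<And>i. i \<in> active s (stage s) \<Longrightarrow> raised P s (step_length P \<tau> s) i \<le> \<tau> * ub P i"
    and step_length_maximal: "step_length P \<tau> s = 1 \<or>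
      (\<exists>i\<in>active s (stage s). raised P s (step_length P \<tau> s) i = \<tau> * ub P i)"
proof -
  let ?T = "active s (stage s)"
  \<comment> \<open>The step length at which variable \<open>i\<close> meets its threshold.\<close>
  define q where "q i = (\<tau> * ub P i - val s i) / slope i" for i
  define \<delta> where "\<delta> = Min (insert 1 (q ` ?T))"
  have q_pos: "0 < q i" if "i \<in> ?T" for i
    unfolding q_def using active_facts(2)[OF that] slope_pos[OF that] by simp
  have fin: "finite (insert 1 (q ` ?T))" using finite_active by simp
  have "\<delta> \<in> insert 1 (q ` ?T)"
    unfolding \<delta>_def using fin by (intro Min_in) auto
  then have in_q: "\<delta> = 1 \<or> (\<exists>i\<in>?T. \<delta> = q i)" by auto
  have iff: "raised P s e i \<le> \<tau> * ub P i \<longleftrightarrow> e \<le> q i" "raised P s e i = \<tau> * ub P i \<longleftrightarrow> e = q i"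
    if "i \<in> ?T" for e i
    using slope_pos[OF that] by (auto simp: raised_eq q_def field_simps)
  have pos: "0 < \<delta>" using in_q q_pos by auto
  have le1: "\<delta> \<le> 1" unfolding \<delta>_def using fin by (intro Min_le) auto
  have leq: "\<delta> \<le> q i" if "i \<in> ?T" for i unfolding \<delta>_def using fin that by (intro Min_le) auto
  have "step_length P \<tau> s = \<delta>"
    unfolding step_length_def
  proof (rule Greatest_equality)
    show "0 < \<delta> \<and> \<delta> \<le> 1 \<and> (\<forall>i\<in>?T. raised P s \<delta> i \<le> \<tau> * ub P i)"
      using pos le1 leq iff by blast
    show "y \<le> \<delta>" if "0 < y \<and> y \<le> 1 \<and> (\<forall>i\<in>?T. raised P s y i \<le> \<tau> * ub P i)" for y
      using that in_q iff by auto
  qed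
  note eq = this
  show "0 < step_length P \<tau> s" "step_length P \<tau> s \<le> 1"
    using pos le1 eq by auto
  show "raised P s (step_length P \<tau> s) i \<le> \<tau> * ub P i" if "i \<in> ?T" for i
    using leq iff that eq by simp
  show "step_length P \<tau> s = 1 \<or> (\<exists>i\<in>?T. raised P s (step_length P \<tau> s) i = \<tau> * ub P i)"
    using in_q iff eq by auto
qed

lemma val_le_lifted: "val s i \<le> lifted s i"
  using step_length_pos slope_pos by (simp add: lifted_def raised_eq less_imp_le)

lemma lifted_in_box: "in_box (lifted s)"
  unfolding in_box_def
proof (intro ballI conjI)
  fix i assume i: "i \<in> {1..nvars P}"
  then have "0 \<le> val s i" "val s i \<le> \<tau> * ub P i"
    using wf_state by (auto simp: well_formed_def in_box_def)
  then show "0 \<le> lifted s i" "lifted s i \<le> \<tau> * ub P i"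
    using val_le_lifted[of i] raised_le by (auto simp: lifted_def)
qed

text \<open>Only active values move, and none passes its threshold; so becoming heavy means reaching
  it exactly.\<close>

lemma heavy_supp_lifted:
  "heavy_supp (arrived s) (lifted s) = heavy_supp (arrived s) (val s) \<union> newly_saturated s"
proof -
  have "lifted s i = val s i" if "i \<notin> active s (stage s)" for i using that by (simp add: lifted_def)
  then have "\<tau> * ub P i \<le> lifted s i \<longleftrightarrow> \<tau> * ub P i \<le> val s i \<or> i \<in> newly_saturated s"
    if "i \<in> supp P (arrived s)" for i
    using that raised_le[of i] by (cases "i \<in> active s (stage s)")
      (auto simp: newly_saturated_def active_eq lifted_def)
  then show ?thesis
    by (auto simp: heavy_supp_def newly_saturated_def active_eq)
qed

lemma lifted_cost:
  assumes guard: "(\<Sum>i\<in>active s (stage s). alpha s i (stage s) * val s i) < 1"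
    and ne: "active s (stage s) \<noteq> {}"
    and z: "ip_feasible P (arrived s) z" and K: "real (param s) \<le> K"
  shows "objective P (lifted s) \<le> 4 * (\<Sum>i\<in>{1..nvars P}. cost P i * gain K (z i) (lifted s i))"
proof -
  let ?T = "active s (stage s)" and ?N = "{1..nvars P}"
  have TN: "?T \<subseteq> ?N" using active_facts(1) by blast
  have old: "objective P (val s) \<le> 4 * (\<Sum>i\<in>?N. cost P i * gain K (z i) (val s i))"
    using wf_state z K by (simp add: well_formed_def)
  have T: "?T = supp P (arrived s) - heavy_supp (arrived s) (val s)"
    and al: "\<And>i. i \<in> ?T \<Longrightarrow> alpha s i (stage s) =
        min 1 (coef P i (arrived s) / residual (arrived s) (val s))"
    and b: "0 < residual (arrived s) (val s)"
    using covering_state by (auto simp: covering_def)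
  have "1 \<le> (\<Sum>i\<in>?T. min 1 (min 1 (coef P i (arrived s) / residual (arrived s) (val s)) * z i))"
    unfolding T residual_def
    using z arrived_in b by (intro knapsack_cover_integral heavy_supp_subset) (auto simp: residual_def)
  also have "\<dots> = (\<Sum>i\<in>?T. min 1 (alpha s i (stage s) * z i))"
    using al by (intro sum.cong) auto
  finally have covz: "1 \<le> (\<Sum>i\<in>?T. min 1 (alpha s i (stage s) * z i))" .
  have step: "(\<Sum>i\<in>?T. cost P i * (lifted s i - val s i))
      \<le> 4 * (\<Sum>i\<in>?T. cost P i * (gain K (z i) (lifted s i) - gain K (z i) (val s i)))"
  proof (rule covering_step_cost[where k = "param s" and d = "min_unit_cost P s"
        and \<delta> = "step_length P \<tau> s" and a = "\<lambda>i. alpha s i (stage s)"])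
    show "0 \<le> z i" if "i \<in> ?T" for i
      using z active_facts(1)[OF that] by (auto simp: ip_feasible_def lp_feasible_def)
    show "lifted s i = val s i + step_length P \<tau> s * (min_unit_cost P s / (cost P i / alpha s i (stage s)))
        * (val s i + 1 / (param s * alpha s i (stage s)))" if "i \<in> ?T" for i
      using that by (simp add: lifted_def raised_eq slope_def unit_cost_def)
    show "min_unit_cost P s \<le> cost P i / alpha s i (stage s)" if "i \<in> ?T" for i
      using active_facts(8)[OF that] by (simp add: unit_cost_def)
    show "1 \<le> real (param s)" "0 \<le> min_unit_cost P s" "0 \<le> step_length P \<tau> s"
      using param_ge_2 min_unit_cost_pos[OF ne] step_length_pos by linarith+
  qed (use finite_active card_active K active_facts step_length_le_1 guard covz in \<open>simp_all\<close>)
  \<comment> \<open>Inactive values do not change, so sums over the active set become differences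
    over all variables. With \<open>f\<close> the identity this is the change of cost, with
    \<open>gain\<close> that of the potential.\<close>
  have restrict: "(\<Sum>i\<in>?T. cost P i * (f (lifted s i) i - f (val s i) i))
      = (\<Sum>i\<in>?N. cost P i * f (lifted s i) i) - (\<Sum>i\<in>?N. cost P i * f (val s i) i)"
    for f :: "real \<Rightarrow> nat \<Rightarrow> real"
  proof -
    have "(\<Sum>i\<in>?T. cost P i * (f (lifted s i) i - f (val s i) i))
        = (\<Sum>i\<in>?N. cost P i * (f (lifted s i) i - f (val s i) i))"
      using TN by (intro sum.mono_neutral_left) (auto simp: lifted_def)
    then show ?thesis by (simp add: right_diff_distrib sum_subtractf)
  qed
  show ?thesis
    using step old restrict[of "\<lambda>x i. x"] restrict[of "\<lambda>x i. gain K (z i) x"]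
    unfolding objective_def by linarith
qed

lemma invar_raise:
  assumes guard: "(\<Sum>i\<in>active s (stage s). alpha s i (stage s) * val s i) < 1"
    and ne: "active s (stage s) \<noteq> {}"
  shows "invar (raise P \<tau> s)"
proof -
  have "lp_covered j (lifted s)" if j: "j \<in> {1..<arrived s}" for j
  proof (rule lp_covered_mono)
    show "lp_covered j (val s)" using wf_state j unfolding well_formed_def by blast
    show "j \<in> {1..ncons P}" using arrived_in j by auto
  qed (rule val_le_lifted)
  then have wf': "well_formed (lift_state s)"
    using wf_state lifted_in_box lifted_cost[OF guard ne] unfolding well_formed_def lift_state_simps
    by blast
  have sat: "saturated (lift_state s) = heavy_supp (arrived s) (lifted s)"
    using covering_state heavy_supp_lifted by (simp add: covering_def)
  show ?thesis
  proof (cases "newly_saturated s = {}")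
    case True
    \<comment> \<open>With no new saturation the heavy set is unchanged, so the stored
      \<open>alpha\<close> remains correct.\<close>
    then have "residual (arrived s) (lifted s) = residual (arrived s) (val s)"
      using heavy_supp_lifted by (simp add: residual_def)
    then have "covering (lift_state s)"
      using covering_state sat True by (simp add: covering_def)
    then show ?thesis using wf' cov True by (simp add: raise_eq invar_def)
  next
    case False
    have "invar (open_stage P (lift_state s))"
      using wf' sat arrived_in by (intro invar_open_stage) auto
    then show ?thesis using False by (simp add: raise_eq)
  qed
qed

end

section \<open>Termination measure for the while loop\<close>

text \<open>A saturating iteration lowers the first summand. A full step closes at least
  \<open>1 / param s\<close> of the total distance to the thresholds, so the scaling by
  \<open>param s\<close> turns it into a drop of the floor by at least 1.\<close>

definition progress :: "state \<Rightarrow> nat" where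
  "progress s = card (supp P (arrived s)) - card (saturated s)
     + nat \<lfloor>param s * (\<Sum>i\<in>{1..nvars P}. \<tau> * ub P i - val s i)\<rfloor>"

lemma progress_raise:
  assumes inv: "invar s" and cov: "phase s = Covering" and ne: "active s (stage s) \<noteq> {}"
  shows "progress (raise P \<tau> s) < progress s"
proof -
  note ctx = inv cov
  let ?gap = "\<lambda>x. \<Sum>i\<in>{1..nvars P}. \<tau> * ub P i - x i"
  have le: "?gap (lifted s) \<le> ?gap (val s)"
    using val_le_lifted[OF ctx] by (intro sum_mono) simp
  have sat: "saturated s = heavy_supp (arrived s) (val s)"
    using covering_state[OF ctx] by (simp add: covering_def)
  have fin: "finite (supp P (arrived s))" using finite_supp[OF arrived_in[OF ctx]] .
  have new: "newly_saturated s \<subseteq> supp P (arrived s) - saturated s"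
    using covering_state[OF ctx] by (auto simp: newly_saturated_def covering_def)
  have floor_le: "nat \<lfloor>param s * ?gap (lifted s)\<rfloor> \<le> nat \<lfloor>param s * ?gap (val s)\<rfloor>"
    using le by (intro nat_mono floor_mono mult_left_mono) auto
  show ?thesis
  proof (cases "newly_saturated s = {}")
    case False
    have sub: "saturated s \<union> newly_saturated s \<subseteq> supp P (arrived s)"
      using new sat heavy_supp_subset by auto
    have "card (saturated s) < card (saturated s \<union> newly_saturated s)"
      using False new sub fin by (intro psubset_card_mono) (auto intro: finite_subset)
    moreover have "card (saturated s \<union> newly_saturated s) \<le> card (supp P (arrived s))"
      using sub fin by (intro card_mono)
    ultimately show ?thesis using floor_le by (simp add: progress_def)
  next
    case True
    then have d1: "step_length P \<tau> s = 1"
      using step_length_maximal[OF ctx] by (auto simp: newly_saturated_def lifted_def)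
    obtain l where l: "l \<in> active s (stage s)" "unit_cost P s l = min_unit_cost P s"
      using min_unit_cost_attained[OF ctx ne] .
    note lf = active_facts[OF ctx l(1)]
    have k: "2 \<le> param s" by (rule param_ge_2[OF ctx])
    \<comment> \<open>The cheapest variable has cost ratio 1, so a full step raises it by its value
      plus \<open>1 / (param s * alpha s l (stage s))\<close>, and \<open>alpha\<close> is at most
      1.\<close>
    have "1 / param s \<le> 1 / (param s * alpha s l (stage s))"
      using k lf by (intro divide_left_mono) auto
    also have "\<dots> \<le> lifted s l - val s l"
      using l lf d1 by (simp add: lifted_def raised_eq[OF ctx] slope_def[OF ctx])
    also have "\<dots> \<le> (\<Sum>i\<in>{1..nvars P}. lifted s i - val s i)"
      using lf val_le_lifted[OF ctx] by (intro member_le_sum) auto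
    also have "\<dots> = ?gap (val s) - ?gap (lifted s)"
      by (simp add: sum_subtractf)
    finally have "param s * (1 / param s) \<le> param s * (?gap (val s) - ?gap (lifted s))"
      by (intro mult_left_mono) auto
    then have drop: "param s * ?gap (lifted s) + 1 \<le> param s * ?gap (val s)"
      using k by (simp add: right_diff_distrib)
    \<comment> \<open>Nonnegativity keeps \<open>nat\<close> from truncating, so the drop by 1 stays
      strict.\<close>
    have "0 \<le> param s * ?gap (lifted s)"
      using lifted_in_box[OF ctx] by (intro mult_nonneg_nonneg sum_nonneg) (auto simp: in_box_def)
    with drop have "nat \<lfloor>param s * ?gap (lifted s)\<rfloor> < nat \<lfloor>param s * ?gap (val s)\<rfloor>"
      by linarith
    then show ?thesis using True by (simp add: progress_def)
  qed
qed

section \<open>Preservation of the invariant by every transition\<close>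

lemma ip_feasible_prefix: "ip_feasible P m z \<Longrightarrow> m' \<le> m \<Longrightarrow> ip_feasible P m' z"
  by (auto simp: ip_feasible_def lp_feasible_def)

text \<open>Feasibility of the instance rules out the output \<open>Infeasible\<close>: for an empty
  active set the knapsack cover inequality would bound an empty sum below by 1.\<close>

lemma active_nonempty:
  assumes inv: "invar s" and cov: "phase s = Covering"
  shows "active s (stage s) \<noteq> {}"
proof
  assume empty: "active s (stage s) = {}"
  note j = arrived_in[OF inv cov]
  obtain z where "ip_feasible P (ncons P) z" using feasible by blast
  then have "1 \<le> (\<Sum>i\<in>supp P (arrived s) - heavy_supp (arrived s) (val s).
      min 1 (min 1 (coef P i (arrived s) / (1 - full_coverage P (arrived s) (heavy_supp (arrived s) (val s)))) * z i))"
    using j covering_state[OF inv cov] heavy_supp_subset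
    by (intro knapsack_cover_integral) (auto simp: covering_def residual_def)
  moreover have "supp P (arrived s) - heavy_supp (arrived s) (val s) = {}"
    using empty covering_state[OF inv cov] by (auto simp: covering_def)
  ultimately show False by simp
qed

text \<open>The negated guard, multiplied by the residual, is the knapsack cover inequality, as
  \<open>?b * min 1 (coef P i ?j / ?b)\<close> equals \<open>min (coef P i ?j) ?b\<close>.\<close>

lemma invar_finish:
  assumes inv: "invar s" and cov: "phase s = Covering"
    and guard: "1 \<le> (\<Sum>i\<in>active s (stage s). alpha s i (stage s) * val s i)"
  shows "invar (s \<lparr> phase := Waiting \<rparr>)"
proof -
  let ?j = "arrived s" and ?b = "residual (arrived s) (val s)" and ?T = "active s (stage s)"
  have b: "0 < ?b" and T: "?T = supp P ?j - heavy_supp ?j (val s)"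
    and al: "\<And>i. i \<in> ?T \<Longrightarrow> alpha s i (stage s) = min 1 (coef P i ?j / ?b)"
    using covering_state[OF inv cov] by (auto simp: covering_def)
  have "?b \<le> ?b * (\<Sum>i\<in>?T. alpha s i (stage s) * val s i)"
    using b guard by simp
  also have "\<dots> = (\<Sum>i\<in>?T. ?b * (alpha s i (stage s) * val s i))"
    by (rule sum_distrib_left)
  also have "\<dots> = (\<Sum>i\<in>?T. min (coef P i ?j) ?b * val s i)"
  proof (rule sum.cong)
    fix i assume "i \<in> ?T"
    moreover have "?b * min 1 (coef P i ?j / ?b) = min (coef P i ?j) ?b"
      using b by (simp add: min_def field_simps)
    ultimately show "?b * (alpha s i (stage s) * val s i) = min (coef P i ?j) ?b * val s i"
      using al by (metis mult.assoc)
  qed simp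
  finally have "knapsack_covered ?j (val s)" by (simp add: knapsack_covered_def T)
  then show ?thesis
    using wf_state[OF inv cov] by (simp add: invar_def well_formed_def)
qed

lemma step_covering_cases:
  assumes inv: "invar s" and cov: "phase s = Covering"
  obtains
    (finish) "1 \<le> (\<Sum>i\<in>active s (stage s). alpha s i (stage s) * val s i)"
      "step P \<tau> s = s \<lparr> phase := Waiting \<rparr>"
  | (raise) "(\<Sum>i\<in>active s (stage s). alpha s i (stage s) * val s i) < 1"
      "step P \<tau> s = raise P \<tau> s"
  using active_nonempty[OF inv cov] cov
  by (cases "(\<Sum>i\<in>active s (stage s). alpha s i (stage s) * val s i) < 1")
    (auto simp: step_def Let_def)

lemma step_waiting:
  "phase s = Waiting \<Longrightarrow> step P \<tau> s = (if arrived s < ncons P then arrive P \<tau> s else s)"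
  by (simp add: step_def)

lemma val_arrive: "val (arrive P \<tau> s) = val s"
  and arrived_arrive: "arrived (arrive P \<tau> s) = Suc (arrived s)"
  by (simp_all add: arrive_def Let_def)

lemma invar_phase: "invar s \<Longrightarrow> phase s = Waiting \<or> phase s = Covering"
  by (cases "phase s") (auto simp: invar_def)

lemma invar_step:
  assumes inv: "invar s" shows "invar (step P \<tau> s)"
  using invar_phase[OF inv]
proof
  assume "phase s = Waiting"
  then show ?thesis using inv invar_arrive by (simp add: step_waiting)
next
  assume cov: "phase s = Covering"
  from inv cov show ?thesis
    by (cases rule: step_covering_cases)
      (auto simp: invar_finish invar_raise active_nonempty inv cov)
qed

lemma val_le_step:
  assumes inv: "invar s" shows "val s i \<le> val (step P \<tau> s) i"
  using invar_phase[OF inv]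
proof
  assume "phase s = Waiting"
  then show ?thesis by (simp add: step_waiting val_arrive)
next
  assume cov: "phase s = Covering"
  from inv cov show ?thesis
    by (cases rule: step_covering_cases) (auto simp: val_le_lifted inv cov)
qed

lemma potential_0_nonneg:
  assumes "ip_feasible P m z" "0 \<le> K"
  shows "0 \<le> (\<Sum>i\<in>{1..nvars P}. cost P i * gain K (z i) 0)"
  using assms cost_pos
  by (intro sum_nonneg mult_nonneg_nonneg gain_nonneg)
    (auto simp: ip_feasible_def lp_feasible_def less_imp_le)

lemma invar_init: "invar init_state"
proof -
  have "in_box (\<lambda>_. 0)" using tau ub_pos by (auto simp: in_box_def less_imp_le)
  then show ?thesis
    using potential_0_nonneg[of 0]
    by (simp add: invar_def init_state_def well_formed_def sparsity_param_0 objective_def)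
qed

section \<open>Monotonicity and termination along the run\<close>

lemma run_Suc: "run P \<tau> (Suc t) = step P \<tau> (run P \<tau> t)"
  by (simp add: run_def)

lemma run_add: "run P \<tau> (t + n) = (step P \<tau> ^^ n) (run P \<tau> t)"
  by (induction n) (simp_all add: run_Suc)

lemma invar_run: "invar (run P \<tau> t)"
  by (induction t) (simp_all add: run_Suc invar_step, simp add: run_def invar_init)

lemma val_run_mono: "t \<le> t' \<Longrightarrow> val (run P \<tau> t) i \<le> val (run P \<tau> t') i"
  by (rule lift_Suc_mono_le[of "\<lambda>t. val (run P \<tau> t) i"])
    (simp_all add: run_Suc val_le_step invar_run)

text \<open>Induction on \<open>progress\<close>, which every raise lowers; once the guard fails, a
  single transition ends the loop.\<close>

lemma covering_terminates:
  assumes "invar s" "phase s = Covering"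
  shows "\<exists>n. phase ((step P \<tau> ^^ n) s) = Waiting \<and> arrived ((step P \<tau> ^^ n) s) = arrived s"
  using assms
proof (induction "progress s" arbitrary: s rule: less_induct)
  case less
  show ?case
    using less.prems
  proof (cases rule: step_covering_cases)
    case finish
    then show ?thesis by (intro exI[of _ 1]) simp
  next
    case raise
    let ?s = "raise P \<tau> s"
    have inv: "invar ?s" using invar_step[OF less.prems(1)] raise by simp
    show ?thesis
      using invar_phase[OF inv]
    proof
      \<comment> \<open>A raise can itself end the loop, when the newly saturated variables make the
        residual nonpositive.\<close>
      assume "phase ?s = Waiting"
      then show ?thesis using raise by (intro exI[of _ 1]) simp
    next
      assume "phase ?s = Covering"
      then obtain n where "phase ((step P \<tau> ^^ n) ?s) = Waiting"
        "arrived ((step P \<tau> ^^ n) ?s) = arrived s"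
        using less.hyps[of ?s] inv progress_raise[OF less.prems active_nonempty[OF less.prems]]
        by auto
      then show ?thesis
        using raise by (intro exI[of _ "Suc n"]) (simp add: funpow_swap1)
    qed
  qed
qed

text \<open>Induction over arrivals: the next constraint is either settled on arrival, its residual
  being nonpositive, or its loop terminates.\<close>

lemma ex_processed: "m \<le> ncons P \<Longrightarrow> \<exists>t. processed P \<tau> m t"
proof (induction m)
  case 0
  show ?case by (intro exI[of _ 0]) (simp add: processed_def run_def init_state_def)
next
  case (Suc m)
  then obtain t where t: "phase (run P \<tau> t) = Waiting" "arrived (run P \<tau> t) = m"
    by (auto simp: processed_def)
  then have arr: "arrived (run P \<tau> (Suc t)) = Suc m"
    using Suc.prems by (simp add: run_Suc step_waiting arrived_arrive)
  show ?case
    using invar_phase[OF invar_run[of "Suc t"]]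
  proof
    assume "phase (run P \<tau> (Suc t)) = Waiting"
    then show ?thesis using arr by (auto simp: processed_def)
  next
    assume "phase (run P \<tau> (Suc t)) = Covering"
    from covering_terminates[OF invar_run this] show ?thesis
      using arr by (metis processed_def run_add)
  qed
qed

section \<open>Feasibility, competitive ratio and knapsack cover property\<close>

lemma processed_lp_feasible:
  assumes "processed P \<tau> m t"
  shows "lp_feasible P m (round_up P \<tau> (val (run P \<tau> t)))"
proof -
  let ?s = "run P \<tau> t"
  have s: "phase ?s = Waiting" "arrived ?s = m" using assms by (simp_all add: processed_def)
  have "0 \<le> round_up P \<tau> (val ?s) i \<and> round_up P \<tau> (val ?s) i \<le> ub P i"
    if i: "i \<in> {1..nvars P}" for i
  proof -
    have "in_box (val ?s)" using invar_run[of t] by (simp add: invar_def well_formed_def)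
    then have "0 \<le> val ?s i" using i by (auto simp: in_box_def)
    moreover have "val ?s i \<le> ub P i" if "val ?s i < \<tau> * ub P i"
    proof -
      have "\<tau> * ub P i \<le> ub P i" using tau ub_pos[OF i] by simp
      with that show ?thesis by linarith
    qed
    ultimately show ?thesis
      using ub_pos[OF i] by (simp add: round_up_def)
  qed
  moreover have "lp_covered j (val ?s)" if "j \<in> {1..m}" for j
    using waiting_lp_covered[OF invar_run s(1)] that s by simp
  ultimately show ?thesis by (auto simp: lp_feasible_def lp_covered_def)
qed

text \<open>The invariant is used with \<open>K\<close> equal to the current parameter. The constant
  16 is the factor 4 of the invariant times the factor 4 of \<open>gain_le\<close>.\<close>

lemma objective_run_le:
  assumes z: "ip_feasible P (arrived (run P \<tau> t)) z"
  shows "objective P (val (run P \<tau> t)) \<le> 16 * log 2 (param (run P \<tau> t)) * objective P z"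
proof -
  let ?s = "run P \<tau> t"
  have wf: "well_formed ?s" using invar_run by (simp add: invar_def)
  then have k: "2 \<le> real (param ?s)"
    using sparsity_param_ge_2[of P "arrived ?s"] by (simp add: well_formed_def)
  have "objective P (val ?s) \<le> 4 * (\<Sum>i\<in>{1..nvars P}. cost P i * gain (param ?s) (z i) (val ?s i))"
    using wf z by (simp add: well_formed_def)
  also have "\<dots> \<le> 4 * (\<Sum>i\<in>{1..nvars P}. cost P i * (4 * log 2 (param ?s) * z i))"
  proof (intro mult_left_mono sum_mono gain_le k)
    fix i assume i: "i \<in> {1..nvars P}"
    show "0 \<le> z i" using z i by (auto simp: ip_feasible_def lp_feasible_def)
    show "0 \<le> val ?s i" using wf i by (auto simp only: well_formed_def in_box_def)
    show "0 \<le> cost P i" using cost_pos[OF i] by simp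
  qed simp
  also have "\<dots> = 16 * log 2 (param ?s) * objective P z"
    by (simp add: objective_def sum_distrib_left mult.left_commute mult.assoc)
  finally show ?thesis .
qed

text \<open>Since \<open>opt_ip\<close> is an infimum, the cost divided by the positive factor is
  shown to be a lower bound of all objective values; no optimal solution has to be attained.\<close>

lemma processed_objective_le:
  assumes "processed P \<tau> m t" "m \<le> ncons P"
  shows "objective P (val (run P \<tau> t)) \<le> 16 * log 2 (param (run P \<tau> t)) * opt_ip P m"
proof -
  let ?s = "run P \<tau> t"
  have m: "arrived ?s = m" using assms by (simp add: processed_def)
  have "well_formed ?s" using invar_run by (simp add: invar_def)
  then have "2 \<le> real (param ?s)"
    using sparsity_param_ge_2[of P "arrived ?s"] by (simp add: well_formed_def)
  then have log: "0 < 16 * log 2 (param ?s)" by simp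
  have "objective P (val ?s) / (16 * log 2 (param ?s)) \<le> opt_ip P m"
    unfolding opt_ip_def
  proof (rule cInf_greatest)
    show "objective P ` {x. ip_feasible P m x} \<noteq> {}"
      \<comment> \<open>A solution of the whole instance also solves each prefix, so the infimum is
        over a nonempty set.\<close>
      using feasible ip_feasible_prefix assms(2) by blast
    show "objective P (val ?s) / (16 * log 2 (param ?s)) \<le> v"
      if "v \<in> objective P ` {x. ip_feasible P m x}" for v
      using that objective_run_le[of t] log m by (auto simp: pos_divide_le_eq mult.commute)
  qed
  then show ?thesis using log by (simp add: pos_divide_le_eq mult.commute)
qed

text \<open>The invariant holds at the first time \<open>j\<close> is processed; it remains to
  replace the heavy part of the support by the heavy set among all variables.\<close>

lemma knapsack_covered_val_after:
  assumes j: "j \<in> {1..ncons P}" and b: "full_coverage P j (heavy P \<tau> j) < 1"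
  shows "1 - full_coverage P j (heavy P \<tau> j) \<le>
    (\<Sum>i\<in>supp P j - heavy P \<tau> j. min (coef P i j) (1 - full_coverage P j (heavy P \<tau> j)) * val_after P \<tau> j i)"
proof -
  let ?x = "val_after P \<tau> j"
  define t where "t = (LEAST t. processed P \<tau> j t)"
  have "processed P \<tau> j t"
    unfolding t_def using LeastI_ex[OF ex_processed[of j]] j by simp
  then have "phase (run P \<tau> t) = Waiting" "arrived (run P \<tau> t) = j"
    by (simp_all add: processed_def)
  then have "knapsack_covered j (val (run P \<tau> t))"
    using invar_run[of t] j by (simp add: invar_def)
  then have kc: "knapsack_covered j ?x" by (simp add: val_after_def t_def)
  have H: "heavy_supp j ?x = heavy P \<tau> j \<inter> supp P j"
    using supp_subset[OF j] by (auto simp: heavy_supp_def heavy_def)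
  \<comment> \<open>Heavy variables outside the support have coefficient 0 and do not affect the
    coverage.\<close>
  have "full_coverage P j (heavy P \<tau> j) = full_coverage P j (heavy_supp j ?x)"
    unfolding full_coverage_def H
    by (intro sum.mono_neutral_right) (auto simp: heavy_def coef_zero[OF j])
  moreover have "supp P j - heavy P \<tau> j = supp P j - heavy_supp j ?x"
    using H by blast
  ultimately show ?thesis
    using kc b by (simp add: knapsack_covered_def residual_def)
qed

end

theorem theorem2:
  "\<exists>C::real. C > 0 \<and>
     (\<forall>(P::cip) (\<tau>::real).
        valid_cip P \<and> 0 < \<tau> \<and> \<tau> < 1/2 \<and> (\<exists>z. ip_feasible P (ncons P) z) \<longrightarrow>
          (\<forall>t. phase (run P \<tau> t) \<noteq> Infeasible) \<and>
          (\<forall>m\<le>ncons P. \<exists>t. processed P \<tau> m t) \<and>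
          (\<forall>m\<le>ncons P. \<forall>t. processed P \<tau> m t \<longrightarrow>
             lp_feasible P m (round_up P \<tau> (val (run P \<tau> t))) \<and>
             objective P (val (run P \<tau> t)) \<le> C * log 2 (real (param (run P \<tau> t))) * opt_ip P m \<and>
             (\<forall>j\<in>{1..m}. full_coverage P j (heavy P \<tau> j) < 1 \<longrightarrow>
                (\<Sum>i\<in>supp P j - heavy P \<tau> j.
                    min (coef P i j) (1 - full_coverage P j (heavy P \<tau> j)) * val_after P \<tau> j i)
                  \<ge> 1 - full_coverage P j (heavy P \<tau> j))) \<and>
          (\<forall>t t'. t \<le> t' \<longrightarrow>
             (\<forall>i\<in>{1..nvars P}.
                val (run P \<tau> t) i \<le> val (run P \<tau> t') i \<and>
                round_up P \<tau> (val (run P \<tau> t)) i \<le> round_up P \<tau> (val (run P \<tau> t')) i)))"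
proof (intro exI[of _ "16::real"] conjI allI impI)
  fix P :: cip and \<tau> :: real
  assume "valid_cip P \<and> 0 < \<tau> \<and> \<tau> < 1/2 \<and> (\<exists>z. ip_feasible P (ncons P) z)"
  then interpret feasible_run P \<tau> by unfold_locales auto
  show "phase (run P \<tau> t) \<noteq> Infeasible" for t
    using invar_phase[OF invar_run[of t]] by auto
  show "\<exists>t. processed P \<tau> m t" if "m \<le> ncons P" for m
    using that by (rule ex_processed)
  fix m t assume m: "m \<le> ncons P" and t: "processed P \<tau> m t"
  show "lp_feasible P m (round_up P \<tau> (val (run P \<tau> t)))"
    using t by (rule processed_lp_feasible)
  show "objective P (val (run P \<tau> t)) \<le> 16 * log 2 (real (param (run P \<tau> t))) * opt_ip P m"
    using t m by (rule processed_objective_le)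
  show "\<forall>j\<in>{1..m}. full_coverage P j (heavy P \<tau> j) < 1 \<longrightarrow>
      (\<Sum>i\<in>supp P j - heavy P \<tau> j.
          min (coef P i j) (1 - full_coverage P j (heavy P \<tau> j)) * val_after P \<tau> j i)
        \<ge> 1 - full_coverage P j (heavy P \<tau> j)"
    using m by (auto intro!: knapsack_covered_val_after)
next
  fix P :: cip and \<tau> :: real and t t' :: nat
  assume "valid_cip P \<and> 0 < \<tau> \<and> \<tau> < 1/2 \<and> (\<exists>z. ip_feasible P (ncons P) z)" and "t \<le> t'"
  then interpret feasible_run P \<tau> by unfold_locales auto
  show "\<forall>i\<in>{1..nvars P}.
      val (run P \<tau> t) i \<le> val (run P \<tau> t') i \<and>
      round_up P \<tau> (val (run P \<tau> t)) i \<le> round_up P \<tau> (val (run P \<tau> t')) i"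
    using \<open>t \<le> t'\<close> by (auto intro: val_run_mono round_up_mono)
qed simp

end
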